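(* Let $G$ have $m$ edges and let $\mathcal{S}_T$ be a state of the rotor-router system on $G$. The following are equivalent: (i) $\mathcal{S}_T$ is stable; (ii) $\mathcal{S}_T$ admits an $\infty$-subcycle decomposition; (iii) $\mathcal{S}_T$ admits a $(2m^2)$-step subcycle decomposition.
   Context: Rotor-router model: $G=(V,E)$ is a finite connected undirected graph with $m$ edges; $\vec G=(V,\vec E)$ replaces each edge $\{u,v\}$ by arcs $(u,v),(v,u)$; $\mathrm{in}(v),\mathrm{out}(v)$ denote incoming/outgoing arcs of $v$. Each vertex $v$ has a fixed cyclic ordering $\rho_v$ of $\mathrm{out}(v)$, with $\mathit{next}(e)$ the successor of $e$ in $\rho_v$. A state $\mathcal{S}_t$ consists of a pointer $\mathit{pointer}_v\in\mathrm{out}(v)$ and a number of identical tokens at each vertex $v$. In each synchronous step every vertex $v$, while it has tokens, sends one token along $\mathit{pointer}_v$ and sets $\mathit{pointer}_v:=\mathit{next}(\mathit{pointer}_v)$; tokens sent at step $t$ are at the heads of their arcs at time $t+1$. $\mathcal{S}_t$ is stable if $\mathcal{S}_{t'}=\mathcal{S}_t$ for some $t'>t$. $\mathcal{L}_t(e)$ is the number of tokens sent along arc $e$ at step $t$. A state $\mathcal{S}_T$ admits a $\Delta t$-step subcycle decomposition if for every vertex $v$ there is a bijection $M_v:\mathrm{in}(v)\to\mathrm{out}(v)$ such that $\mathcal{L}_t(e)=\mathcal{L}_{t+1}(M_v(e))$ for all $e\in\mathrm{in}(v)$ and all integers $t$ with $T\le t<T+\Delta t$. It admits an $\infty$-subcycle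 decomposition if it admits a $\Delta t$-step subcycle decomposition for arbitrarily large $\Delta t$. *)

theory Defs
  imports Main "HOL-Combinatorics.Orbits"
begin

text \<open>
  An arc \<open>(u, v)\<close> has tail \<open>u = fst (u, v)\<close> and head \<open>v = snd (u, v)\<close>.
\<close>

definition arcs :: "'v set set \<Rightarrow> ('v \<times> 'v) set" where
  "arcs E = {(u, v). {u, v} \<in> E}"

definition in_arcs :: "'v set set \<Rightarrow> 'v \<Rightarrow> ('v \<times> 'v) set" where
  "in_arcs E v = {e \<in> arcs E. snd e = v}"

definition out_arcs :: "'v set set \<Rightarrow> 'v \<Rightarrow> ('v \<times> 'v) set" where
  "out_arcs E v = {e \<in> arcs E. fst e = v}"

text \<open>
  The cyclic orderings \<open>\<rho>\<^sub>v\<close> are given by their common successor function \<open>next_arc\<close>, which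
  must permute each \<open>out_arcs E v\<close> in a single cycle. Since \<open>cyclic_on f {}\<close> is false, the
  empty cyclic ordering (of an isolated vertex) has to be allowed separately.
\<close>

locale rotor_router =
  fixes V :: "'v set" and E :: "'v set set" and next_arc :: "'v \<times> 'v \<Rightarrow> 'v \<times> 'v"
  assumes finite_vertices: "finite V"
    and edges: "E \<subseteq> {{u, v} | u v. u \<in> V \<and> v \<in> V \<and> u \<noteq> v}"
    and connected: "\<And>u v. u \<in> V \<Longrightarrow> v \<in> V \<Longrightarrow> (u, v) \<in> (arcs E)\<^sup>*"
    and cyclic_ordering:
      "\<And>v. v \<in> V \<Longrightarrow> out_arcs E v \<noteq> {} \<Longrightarrow> cyclic_on next_arc (out_arcs E v)"

record 'v rr_state =
  pointer :: "'v \<Rightarrow> 'v \<times> 'v"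
  tokens :: "'v \<Rightarrow> nat"

text \<open>
  There are no tokens outside \<open>V\<close>. Hence a step changes neither component outside \<open>V\<close>, and
  equality of two states of the same run is equality of pointers and token counts on \<open>V\<close>.
\<close>

definition is_state :: "'v set \<Rightarrow> 'v set set \<Rightarrow> 'v rr_state \<Rightarrow> bool" where
  "is_state V E s \<longleftrightarrow>
     (\<forall>v\<in>V. pointer s v \<in> out_arcs E v) \<and> (\<forall>v. v \<notin> V \<longrightarrow> tokens s v = 0)"

text \<open>
  With \<open>k\<close> tokens at \<open>v\<close>, the arcs used successively by \<open>v\<close> during a step are
  \<open>(next_arc ^^ i) (pointer s v)\<close> for \<open>i = 0, \<dots>, k - 1\<close>.
\<close>

definition load :: "('v \<times> 'v \<Rightarrow> 'v \<times> 'v) \<Rightarrow> 'v rr_state \<Rightarrow> 'v \<times> 'v \<Rightarrow> nat" where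
  "load next_arc s e =
     card {i. i < tokens s (fst e) \<and> (next_arc ^^ i) (pointer s (fst e)) = e}"

definition step ::
  "'v set set \<Rightarrow> ('v \<times> 'v \<Rightarrow> 'v \<times> 'v) \<Rightarrow> 'v rr_state \<Rightarrow> 'v rr_state" where
  "step E next_arc s =
     \<lparr> pointer = (\<lambda>v. (next_arc ^^ tokens s v) (pointer s v)),
       tokens = (\<lambda>v. \<Sum>e\<in>in_arcs E v. load next_arc s e) \<rparr>"

definition is_run ::
  "'v set \<Rightarrow> 'v set set \<Rightarrow> ('v \<times> 'v \<Rightarrow> 'v \<times> 'v) \<Rightarrow> (nat \<Rightarrow> 'v rr_state) \<Rightarrow> bool" where
  "is_run V E next_arc S \<longleftrightarrow>
     is_state V E (S 0) \<and> (\<forall>t. S (Suc t) = step E next_arc (S t))"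

definition stable_at :: "(nat \<Rightarrow> 'v rr_state) \<Rightarrow> nat \<Rightarrow> bool" where
  "stable_at S t \<longleftrightarrow> (\<exists>t'>t. S t' = S t)"

definition subcycle_decomposition ::
  "'v set \<Rightarrow> 'v set set \<Rightarrow> ('v \<times> 'v \<Rightarrow> 'v \<times> 'v) \<Rightarrow> (nat \<Rightarrow> 'v rr_state) \<Rightarrow> nat \<Rightarrow> nat \<Rightarrow> bool"
where
  "subcycle_decomposition V E next_arc S T d \<longleftrightarrow>
     (\<forall>v\<in>V. \<exists>M. bij_betw M (in_arcs E v) (out_arcs E v) \<and>
        (\<forall>e\<in>in_arcs E v. \<forall>t. T \<le> t \<and> t < T + d \<longrightarrow>
           load next_arc (S t) e = load next_arc (S (t + 1)) (M e)))"

definition infinite_subcycle_decomposition ::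
  "'v set \<Rightarrow> 'v set set \<Rightarrow> ('v \<times> 'v \<Rightarrow> 'v \<times> 'v) \<Rightarrow> (nat \<Rightarrow> 'v rr_state) \<Rightarrow> nat \<Rightarrow> bool"
where
  "infinite_subcycle_decomposition V E next_arc S T \<longleftrightarrow>
     (\<forall>n. \<exists>d\<ge>n. subcycle_decomposition V E next_arc S T d)"

end

theory Submission
  imports Defs "HOL-Combinatorics.Cycles"
begin

text \<open>
  Round robin keeps the loads of two arcs leaving a common vertex within one of each other, over
  every time window; given the number of tokens sent, this determines the loads. Balanced loads
  minimise the sum of squares, so for each window length the sum of the squared window loads of all
  arcs never increases as the window moves. Along a period it is constant, which forces the windows
  of the incoming arcs to be balanced as well; cumulative loads of incoming and of outgoing arcs are
  then linearly ordered families with equal sums, and matching them in increasing order gives the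
  bijections. Conversely, a decomposition predicts periodic loads. Two arcs have a common period of
  at most \<open>m\<^sup>2\<close>, and being balanced during two periods rules out any drift between them, so the
  prediction stays balanced forever and agrees with the actual run.
\<close>

section \<open>Integer sequences whose differences take two consecutive values\<close>

text \<open>If \<open>x e > y e\<close>, equal sums force some \<open>f\<close> with
  \<open>x f < y f\<close>. Then \<open>x e - x f\<close> exceeds \<open>y e - y f\<close> by at
  least 2, impossible for two members of \<open>{D, D + 1}\<close>.\<close>

lemma two_values_unique:
  fixes x y :: "'a \<Rightarrow> int"
  assumes "finite A" "sum x A = sum y A"
    and two: "\<And>e f. e \<in> A \<Longrightarrow> f \<in> A \<Longrightarrow>
      \<exists>D. x e - x f \<in> {D, D + 1} \<and> y e - y f \<in> {D, D + 1}"
    and "e \<in> A"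
  shows "x e = y e"
proof -
  have le: "u e \<le> w e"
    if sums: "sum u A = sum w A"
      and two': "\<And>e f. e \<in> A \<Longrightarrow> f \<in> A \<Longrightarrow>
        \<exists>D. u e - u f \<in> {D, D + 1} \<and> w e - w f \<in> {D, D + 1}"
    for u w :: "'a \<Rightarrow> int"
  proof (rule ccontr)
    assume gt: "\<not> u e \<le> w e"
    have "\<exists>f\<in>A. u f < w f"
    proof (rule ccontr)
      assume "\<not> (\<exists>f\<in>A. u f < w f)"
      then have "sum w A < sum u A"
        using gt \<open>finite A\<close> \<open>e \<in> A\<close>
        by (intro sum_strict_mono_ex1) (auto simp: not_less not_le)
      with sums show False by simp
    qed
    then obtain f where "f \<in> A" "u f < w f" by blast
    with two'[OF \<open>e \<in> A\<close> \<open>f \<in> A\<close>] gt show False by auto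
  qed
  show ?thesis
    using le[of x y] le[of y x] assms(2) two by (metis order_antisym)
qed

text \<open>Applied to the difference of two cumulative loads, this turns balance over every window
  into one \<open>D\<close> valid for all times.\<close>

lemma two_values_if_close:
  fixes q :: "nat \<Rightarrow> int"
  assumes "\<And>i j. \<bar>q i - q j\<bar> \<le> 1"
  shows "\<exists>D. \<forall>i. q i \<in> {D, D + 1}"
proof (cases "\<exists>j. q j < q 0")
  case True
  then obtain j where "q j < q 0" by blast
  with assms[of _ j] assms[of _ 0] have "q i \<in> {q 0 - 1, q 0 - 1 + 1}" for i
    by (smt (verit) insert_iff)
  then show ?thesis by blast
next
  case False
  with assms[of _ 0] have "q i \<in> {q 0, q 0 + 1}" for i
    by (smt (verit) insert_iff)
  then show ?thesis by blast
qed

text \<open>The drift \<open>q p\<close> per period vanishes because \<open>q 0 = 0\<close>, \<open>q p\<close> and \<open>q (2 p) = 2 * q p\<close>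
  all lie in \<open>{D, D + 1}\<close>.\<close>
lemma two_values_extend:
  fixes q :: "nat \<Rightarrow> int"
  assumes add: "\<And>j. q (j + p) = q j + q p" and "0 < p"
    and two: "\<And>j. j \<le> 2 * p \<Longrightarrow> q j \<in> {D, D + 1}"
  shows "q j \<in> {D, D + 1}"
proof -
  have q0: "q 0 = 0" using add[of 0] by simp
  have q2: "q (2 * p) = 2 * q p" using add[of p] by (simp only: mult_2)
  have "0 = D \<or> 0 = D + 1" "q p = D \<or> q p = D + 1" "2 * q p = D \<or> 2 * q p = D + 1"
    using two[of 0] two[of p] two[of "2 * p"] by (simp_all add: q0 q2)
  then have "q p = 0" by arith
  show ?thesis
  proof (induction j rule: less_induct)
    case (less j)
    show ?case
    proof (cases "j \<le> 2 * p")
      case False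
      then show ?thesis
        using less[of "j - p"] add[of "j - p"] \<open>q p = 0\<close> \<open>0 < p\<close> by simp
    qed (rule two)
  qed
qed

text \<open>For integers \<open>(x - a) * (x - a - 1) \<ge> 0\<close>, with equality iff \<open>x\<close> is \<open>a\<close> or \<open>a + 1\<close>.\<close>
lemma sum_squares_balanced:
  fixes x :: "'a \<Rightarrow> int" and y :: "'b \<Rightarrow> int"
  assumes fin: "finite A" "finite B" and card: "card A = card B"
    and sums: "sum x A = sum y B"
    and bal: "\<And>f g. f \<in> B \<Longrightarrow> g \<in> B \<Longrightarrow> \<bar>y f - y g\<bar> \<le> 1"
  shows "(\<Sum>f\<in>B. (y f)\<^sup>2) \<le> (\<Sum>e\<in>A. (x e)\<^sup>2)"
    and "(\<Sum>f\<in>B. (y f)\<^sup>2) = (\<Sum>e\<in>A. (x e)\<^sup>2) \<Longrightarrow> e \<in> A \<Longrightarrow> e' \<in> A \<Longrightarrow> \<bar>x e - x e'\<bar> \<le> 1"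
proof -
  define a where "a = Min (y ` B)"
  define g where "g = (\<lambda>z::int. (z - a) * (z - a - 1))"
  \<comment> \<open>The sum of \<open>g\<close> and the sum of squares differ by terms depending
    only on the total and the cardinality, which \<open>A\<close> and \<open>B\<close> share.
    Comparing sums of squares thus means comparing sums of \<open>g\<close>, and the one over
    \<open>B\<close> is 0.\<close>
  have expand: "(\<Sum>e\<in>C. g (z e)) = (\<Sum>e\<in>C. (z e)\<^sup>2) - (2 * a + 1) * sum z C + int (card C) * (a * (a + 1))"
    for z :: "'c \<Rightarrow> int" and C
    by (induction C rule: infinite_finite_induct)
      (simp_all add: g_def power2_eq_square algebra_simps)
  have g0: "g z \<ge> 0" for z
  proof -
    consider "z \<le> a" | "z \<ge> a + 1" by linarith
    then show ?thesis
      by cases (auto simp: g_def mult_nonpos_nonpos)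
  qed
  have "g (y f) = 0" if "f \<in> B" for f
  proof -
    have "a \<in> y ` B" unfolding a_def using fin that by (intro Min_in) auto
    moreover have "a \<le> y f" unfolding a_def using fin that by simp
    ultimately have "y f = a \<or> y f = a + 1" using bal that by force
    then show ?thesis by (auto simp: g_def)
  qed
  then have "(\<Sum>f\<in>B. g (y f)) = 0" by simp
  with expand[of y B] expand[of x A] card sums
  have diff: "(\<Sum>e\<in>A. (x e)\<^sup>2) - (\<Sum>f\<in>B. (y f)\<^sup>2) = (\<Sum>e\<in>A. g (x e))" by simp
  with g0 show "(\<Sum>f\<in>B. (y f)\<^sup>2) \<le> (\<Sum>e\<in>A. (x e)\<^sup>2)"
    using sum_nonneg[of A "\<lambda>e. g (x e)"] by simp
  assume "(\<Sum>f\<in>B. (y f)\<^sup>2) = (\<Sum>e\<in>A. (x e)\<^sup>2)" "e \<in> A" "e' \<in> A"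
  with diff have "(\<Sum>e\<in>A. g (x e)) = 0" by simp
  then have "\<forall>e\<in>A. g (x e) = 0" using g0 fin by (simp add: sum_nonneg_eq_0_iff)
  with \<open>e \<in> A\<close> \<open>e' \<in> A\<close> have "g (x e) = 0" "g (x e') = 0" by auto
  then show "\<bar>x e - x e'\<bar> \<le> 1" by (auto simp: g_def)
qed

text \<open>The assumptions make the pointwise order of the sequences \<open>x e\<close> total up to time \<open>d\<close>, so
  sorting by the sum of the first terms enumerates \<open>A\<close> in pointwise increasing order.\<close>
lemma ex_increasing_enumeration:
  fixes x :: "'a \<Rightarrow> nat \<Rightarrow> nat"
  assumes "finite A"
    and zero: "\<And>e. e \<in> A \<Longrightarrow> x e 0 = 0"
    and two: "\<And>e f. e \<in> A \<Longrightarrow> f \<in> A \<Longrightarrow> \<exists>D. \<forall>k. int (x e k) - int (x f k) \<in> {D, D + 1}"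
  shows "\<exists>h. bij_betw h {..<card A} A \<and>
    (\<forall>i j k. i \<le> j \<and> j < card A \<and> k \<le> d \<longrightarrow> int (x (h j) k) - int (x (h i) k) \<in> {0, 1})"
proof -
  define key where "key e = (\<Sum>k\<le>d. x e k)" for e
  obtain ys where ys: "set ys = A" "distinct ys"
    using finite_distinct_list \<open>finite A\<close> by blast
  define xs where "xs = sort_key key ys"
  have xs: "set xs = A" "distinct xs" "sorted (map key xs)" "length xs = card A"
    using ys by (auto simp: xs_def distinct_card)
  have "bij_betw ((!) xs) {..<card A} A"
    using xs by (intro bij_betw_nth) auto
  moreover have "int (x (xs ! j) k) - int (x (xs ! i) k) \<in> {0, 1}"
    if "i \<le> j" "j < card A" "k \<le> d" for i j k
  proof -
    have mem: "xs ! i \<in> A" "xs ! j \<in> A" using that xs(4) nth_mem[of _ xs] by (simp_all add: xs(1))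
    obtain D where D: "\<And>k. int (x (xs ! j) k) - int (x (xs ! i) k) \<in> {D, D + 1}"
      using two mem by blast
    \<comment> \<open>At time 0 both sequences vanish, so 0 lies in
      \<open>{D, D + 1}\<close>.\<close>
    have "D = 0 \<or> D = - 1" using D[of 0] zero mem by auto
    then show ?thesis
    proof
      \<comment> \<open>Here \<open>xs ! j\<close> is pointwise below \<open>xs ! i\<close> although
        its key is not smaller. So the keys are equal, and with them all terms up to
        \<open>d\<close>.\<close>
      assume "D = - 1"
      with D have le: "x (xs ! j) k \<le> x (xs ! i) k" for k
        by (smt (verit, best) insert_iff of_nat_le_iff singletonD)
      have "key (xs ! i) \<le> key (xs ! j)"
        using xs that sorted_nth_mono[OF xs(3), of i j] by simp
      then have "key (xs ! j) = key (xs ! i)"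
        using le by (simp add: key_def sum_mono order_antisym)
      then have "x (xs ! j) k = x (xs ! i) k"
        unfolding key_def using le that
        by (metis (no_types, lifting) atMost_iff finite_atMost sum_mono_inv)
      then show ?thesis by simp
    qed (use D in auto)
  qed
  ultimately show ?thesis by blast
qed

text \<open>With both families listed increasingly, the differences between positions
  \<open>i\<close> and \<open>j\<close> at a given time lie in the same pair of consecutive values
  for both. Equal totals then make entries at equal positions agree by
  \<open>two_values_unique\<close>.\<close>

lemma ex_matching:
  fixes x :: "'a \<Rightarrow> nat \<Rightarrow> nat" and y :: "'b \<Rightarrow> nat \<Rightarrow> nat"
  assumes fin: "finite A" "finite B" and card: "card A = card B"
    and sums: "\<And>k. (\<Sum>e\<in>A. x e k) = (\<Sum>f\<in>B. y f k)"
    and zero: "\<And>e. e \<in> A \<Longrightarrow> x e 0 = 0" "\<And>f. f \<in> B \<Longrightarrow> y f 0 = 0"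
    and two: "\<And>e f. e \<in> A \<Longrightarrow> f \<in> A \<Longrightarrow> \<exists>D. \<forall>k. int (x e k) - int (x f k) \<in> {D, D + 1}"
      "\<And>e f. e \<in> B \<Longrightarrow> f \<in> B \<Longrightarrow> \<exists>D. \<forall>k. int (y e k) - int (y f k) \<in> {D, D + 1}"
  shows "\<exists>M. bij_betw M A B \<and> (\<forall>e\<in>A. \<forall>k\<le>d. x e k = y (M e) k)"
proof -
  obtain h where h: "bij_betw h {..<card A} A"
    "\<And>i j k. i \<le> j \<Longrightarrow> j < card A \<Longrightarrow> k \<le> d \<Longrightarrow> int (x (h j) k) - int (x (h i) k) \<in> {0, 1}"
    using ex_increasing_enumeration[where A = A and x = x and d = d] fin(1) zero(1) two(1) by metis
  obtain h' where h': "bij_betw h' {..<card A} B"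
    "\<And>i j k. i \<le> j \<Longrightarrow> j < card A \<Longrightarrow> k \<le> d \<Longrightarrow> int (y (h' j) k) - int (y (h' i) k) \<in> {0, 1}"
    using ex_increasing_enumeration[where A = B and x = y and d = d] fin(2) zero(2) two(2) card
    by metis
  have eq: "x (h i) k = y (h' i) k" if "i < card A" "k \<le> d" for i k
  proof -
    have "int (x (h i) k) = int (y (h' i) k)"
    proof (rule two_values_unique[where A = "{..<card A}"
          and x = "\<lambda>i. int (x (h i) k)" and y = "\<lambda>i. int (y (h' i) k)"])
      show "(\<Sum>i<card A. int (x (h i) k)) = (\<Sum>i<card A. int (y (h' i) k))"
        using sum.reindex_bij_betw[OF h(1), of "\<lambda>e. x e k"]
          sum.reindex_bij_betw[OF h'(1), of "\<lambda>e. y e k"] sums[of k]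
        by (simp flip: of_nat_sum)
      fix i j assume ij: "i \<in> {..<card A}" "j \<in> {..<card A}"
      show "\<exists>D. int (x (h i) k) - int (x (h j) k) \<in> {D, D + 1} \<and>
          int (y (h' i) k) - int (y (h' j) k) \<in> {D, D + 1}"
      proof (cases "i \<le> j")
        case True
        then show ?thesis
          using h(2)[of i j k] h'(2)[of i j k] ij that(2) by (intro exI[of _ "- 1"]) auto
      next
        case False
        then show ?thesis
          using h(2)[of j i k] h'(2)[of j i k] ij that(2) by (intro exI[of _ 0]) auto
      qed
    qed (use that in auto)
    then show ?thesis by simp
  qed
  let ?M = "h' \<circ> inv_into {..<card A} h"
  have "bij_betw ?M A B"
    using bij_betw_inv_into[OF h(1)] h'(1) by (rule bij_betw_trans)
  moreover have "x e k = y (?M e) k" if "e \<in> A" "k \<le> d" for e k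
  proof -
    have "inv_into {..<card A} h e < card A" "h (inv_into {..<card A} h e) = e"
      using h(1) that bij_betw_imp_surj_on[OF h(1)]
      by (metis inv_into_into lessThan_iff, metis f_inv_into_f)
    then show ?thesis using eq[of "inv_into {..<card A} h e" k] that by simp
  qed
  ultimately show ?thesis by blast
qed

section \<open>Iteration of permutations\<close>

text \<open>Disjoint orbits have lengths with sum at most \<open>2 * m\<close>, so their product, a
  common period, is at most \<open>m ^ 2\<close> by the inequality of arithmetic and geometric
  means. In a shared orbit its length is a common period, at most \<open>2 * m\<close>, hence at
  most \<open>m ^ 2\<close> because \<open>2 \<le> m\<close>.\<close>

lemma permutes_common_period:
  assumes s: "s permutes A" and fin: "finite A" and card: "card A \<le> 2 * m" and m: "2 \<le> m"
    and mem: "e \<in> A" "f \<in> A"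
  shows "\<exists>p>0. p \<le> m ^ 2 \<and> (s ^^ p) e = e \<and> (s ^^ p) f = f"
proof -
  have perm: "permutation s" using s fin by (auto simp: permutation_permutes)
  define c where "c e = funpow_dist1 s e e" for e
  have period: "(s ^^ c z) z = z" "orbit s z = (\<lambda>n. (s ^^ n) z) ` {0..<c z}" "card (orbit s z) = c z" "0 < c z" for z
  proof -
    have self: "z \<in> orbit s z" using perm by (rule permutation_self_in_orbit)
    show "(s ^^ c z) z = z" unfolding c_def using self by (rule funpow_dist1_prop)
    show orb: "orbit s z = (\<lambda>n. (s ^^ n) z) ` {0..<c z}"
      unfolding c_def using self by (rule orbit_conv_funpow_dist1)
    show "card (orbit s z) = c z"
      unfolding orb using inj_on_funpow_dist1[OF self] by (simp add: card_image c_def)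
  qed (simp add: c_def)
  have sub: "orbit s e \<subseteq> A" "orbit s f \<subseteq> A" using permutes_orbit_subset s mem by metis+
  have mult: "(s ^^ (n * c z)) z = z" for n z
    by (induction n) (simp_all add: funpow_add period(1))
  show ?thesis
  proof (cases "orbit s e \<inter> orbit s f = {}")
    case True
    then have "card (orbit s e) + card (orbit s f) \<le> card A"
      using fin sub by (metis card_Un_disjoint card_mono finite_subset le_sup_iff)
    then have le: "c e + c f \<le> 2 * m" using card period(3) by simp
    have "int (4 * (c e * c f)) \<le> int ((c e + c f)\<^sup>2)"
      using zero_le_power2[of "int (c e) - int (c f)"]
      by (simp add: power2_eq_square algebra_simps)
    then have "4 * (c e * c f) \<le> (c e + c f)\<^sup>2" by linarith
    also have "\<dots> \<le> (2 * m)\<^sup>2" using le by (rule power_mono) simp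
    finally have "c e * c f \<le> m ^ 2" by (simp add: power_mult_distrib)
    then show ?thesis
      using mult[of "c e" f] mult[of "c f" e] period(4)
      by (intro exI[of _ "c e * c f"]) (auto simp: mult.commute)
  next
    case False
    then have "orbit s e = orbit s f"
      using perm by (metis cyclic_on_orbit' disjoint_iff orbit_cyclic_eq3)
    then have "c f = c e" using period(3) by metis
    moreover have "c e \<le> card A" using period(3) sub fin by (metis card_mono)
    moreover have "2 * m \<le> m ^ 2" using m by (simp add: power2_eq_square)
    ultimately show ?thesis
      using period(1)[of e] period(1)[of f] period(4)[of e] card by (intro exI[of _ "c e"]) auto
  qed
qed

section \<open>Visit counts of a round robin\<close>

text \<open>Detaches the count in \<open>load\<close> from states, so that the tokens of consecutive
  steps can be concatenated into one longer walk of the rotor.\<close>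

definition visits :: "('a \<Rightarrow> 'a) \<Rightarrow> 'a \<Rightarrow> nat \<Rightarrow> 'a \<Rightarrow> nat" where
  "visits f p n x = card {i. i < n \<and> (f ^^ i) p = x}"

lemma visits_0 [simp]: "visits f p 0 x = 0"
  by (simp add: visits_def)

lemma visits_Suc: "visits f p (Suc n) x = visits f p n x + (if (f ^^ n) p = x then 1 else 0)"
proof -
  have "{i. i < Suc n \<and> (f ^^ i) p = x} =
      (if (f ^^ n) p = x then insert n {i. i < n \<and> (f ^^ i) p = x} else {i. i < n \<and> (f ^^ i) p = x})"
    by (auto simp: less_Suc_eq)
  then show ?thesis by (simp add: visits_def)
qed

lemma visits_add: "visits f p (k + n) x = visits f p k x + visits f ((f ^^ k) p) n x"
proof (induction n)
  case (Suc n)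
  have "(f ^^ (k + n)) p = (f ^^ n) ((f ^^ k) p)"
    by (simp add: funpow_add add.commute[of k])
  with Suc show ?case by (simp add: visits_Suc)
qed simp

lemma sum_visits:
  assumes "cyclic_on f A" "p \<in> A"
  shows "(\<Sum>x\<in>A. visits f p n x) = n"
proof (induction n)
  case (Suc n)
  then show ?case
    using finite_cyclic_on[OF assms(1)] cyclic_on_funpow_in[OF assms, of n]
    by (simp add: visits_Suc sum.distrib)
qed simp

lemma cyclic_on_period:
  assumes "cyclic_on f A" "p \<in> A"
  shows "(f ^^ card A) p = p" and "bij_betw (\<lambda>i. (f ^^ i) p) {0..<card A} A"
proof -
  have orb: "orbit f p = A" using assms by (rule orbit_cyclic_eq3)
  then have self: "p \<in> orbit f p" using assms by simp
  have inj: "inj_on (\<lambda>i. (f ^^ i) p) {0..<funpow_dist1 f p p}"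
    by (rule inj_on_funpow_dist1[OF self])
  have A: "A = (\<lambda>i. (f ^^ i) p) ` {0..<funpow_dist1 f p p}"
    using orbit_conv_funpow_dist1[OF self] orb by simp
  have card: "card A = funpow_dist1 f p p"
    using card_image[OF inj] A by simp
  show "(f ^^ card A) p = p" unfolding card using self by (rule funpow_dist1_prop)
  show "bij_betw (\<lambda>i. (f ^^ i) p) {0..<card A} A"
    unfolding card bij_betw_def using inj A by blast
qed

lemma cyclic_on_funpow_dvd:
  assumes "cyclic_on f A" "p \<in> A" "card A dvd n"
  shows "(f ^^ n) p = p"
  using funpow_mod_eq[OF cyclic_on_period(1)[OF assms(1,2)], of n] assms(3) by simp

text \<open>The visits to \<open>(f ^^ i) p\<close> occur at times \<open>i\<close>,
  \<open>i + card A\<close> and so on. Their number is \<open>n - i\<close> over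
  \<open>card A\<close> rounded up; the offset \<open>card A - 1 - i\<close> rewrites this as a
  rounded-down quotient of naturals.\<close>

lemma visits_cyclic:
  assumes cyc: "cyclic_on f A" "p \<in> A" and i: "i < card A"
  shows "visits f p n ((f ^^ i) p) = (n + (card A - 1 - i)) div card A"
proof (induction n)
  case 0
  then show ?case using i by simp
next
  case (Suc n)
  let ?d = "card A"
  have "(f ^^ n) p = (f ^^ (n mod ?d)) p"
    using funpow_mod_eq[OF cyclic_on_period(1)[OF cyc], of n] by simp
  then have "(f ^^ n) p = (f ^^ i) p \<longleftrightarrow> n mod ?d = i"
    using cyclic_on_period(2)[OF cyc] i by (auto simp: bij_betw_def inj_on_def)
  \<comment> \<open>By \<open>div_Suc\<close> the quotient jumps exactly when this remainder is 0,
    which must coincide with a visit.\<close>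
  moreover have "Suc (n + (?d - 1 - i)) mod ?d = 0 \<longleftrightarrow> n mod ?d = i"
  proof -
    define r where "r = n mod ?d"
    have r: "r < ?d" using i by (simp add: r_def)
    have "Suc (n + (?d - 1 - i)) = n + (?d - i)" using i by simp
    then have "Suc (n + (?d - 1 - i)) mod ?d = (n mod ?d + (?d - i)) mod ?d"
      by (simp only: mod_add_left_eq)
    also have "\<dots> = (if r < i then r + (?d - i) else r - i)"
    proof (cases "r < i")
      case False
      then have "r + (?d - i) = (r - i) + ?d" using i by simp
      then have "(r + (?d - i)) mod ?d = (r - i) mod ?d" by (simp only: mod_add_self2)
      with False r show ?thesis by (simp flip: r_def add: less_imp_diff_less)
    qed (use i r in \<open>auto simp flip: r_def\<close>)
    finally show ?thesis using i by (auto simp flip: r_def)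
  qed
  ultimately show ?case using Suc by (auto simp: visits_Suc div_Suc)
qed

text \<open>\<open>D\<close> is independent of \<open>n\<close> because it reflects only the order
  on the cycle: the element met first after starting at \<open>p\<close> is always ahead by 0 or
  1.\<close>

lemma visits_two_values:
  assumes cyc: "cyclic_on f A" "p \<in> A" and mem: "x \<in> A" "y \<in> A"
  shows "\<exists>D. \<forall>n. int (visits f p n x) - int (visits f p n y) \<in> {D, D + 1}"
proof -
  let ?d = "card A"
  have "x \<in> (\<lambda>i. (f ^^ i) p) ` {0..<?d}" "y \<in> (\<lambda>i. (f ^^ i) p) ` {0..<?d}"
    using mem bij_betw_imp_surj_on[OF cyclic_on_period(2)[OF cyc]] by simp_all
  then obtain i j where ij: "i < ?d" "j < ?d" "x = (f ^^ i) p" "y = (f ^^ j) p"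
    by auto
  \<comment> \<open>The arguments of the two quotients in \<open>visits_cyclic\<close> differ by
    less than \<open>card A\<close>.\<close>
  have near: "k div ?d \<le> l div ?d \<and> l div ?d \<le> k div ?d + 1" if "k \<le> l" "l < k + ?d" for k l
  proof -
    have "l div ?d \<le> (k + ?d) div ?d" using that by (intro div_le_mono) simp
    also have "\<dots> = k div ?d + 1" using ij(1) by (intro div_add_self2) linarith
    finally show ?thesis using that by (simp add: div_le_mono)
  qed
  have vx: "visits f p n x = (n + (?d - 1 - i)) div ?d"
    and vy: "visits f p n y = (n + (?d - 1 - j)) div ?d" for n
    using visits_cyclic[OF cyc] ij by auto
  show ?thesis
  proof (cases "i \<le> j")
    case True
    then have "visits f p n y \<le> visits f p n x \<and> visits f p n x \<le> visits f p n y + 1" for n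
      unfolding vx vy using ij by (intro near) linarith+
    then have "int (visits f p n x) - int (visits f p n y) \<in> {0, 0 + 1}" for n
      by (smt (verit) insert_iff of_nat_1 of_nat_add of_nat_mono)
    then show ?thesis by blast
  next
    case False
    then have "visits f p n x \<le> visits f p n y \<and> visits f p n y \<le> visits f p n x + 1" for n
      unfolding vx vy using ij by (intro near) linarith+
    then have "int (visits f p n x) - int (visits f p n y) \<in> {- 1, - 1 + 1}" for n
      by (smt (verit) insert_iff of_nat_1 of_nat_add of_nat_mono)
    then show ?thesis by blast
  qed
qed

section \<open>Loads of time windows\<close>

definition window_load ::
  "('v \<times> 'v \<Rightarrow> 'v \<times> 'v) \<Rightarrow> (nat \<Rightarrow> 'v rr_state) \<Rightarrow> nat \<Rightarrow> nat \<Rightarrow> 'v \<times> 'v \<Rightarrow> nat" where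
  "window_load next_arc S s k e = (\<Sum>i<k. load next_arc (S (s + i)) e)"

lemma window_load_0 [simp]: "window_load next_arc S s 0 e = 0"
  by (simp add: window_load_def)

lemma window_load_Suc:
  "window_load next_arc S s (Suc k) e = window_load next_arc S s k e + load next_arc (S (s + k)) e"
  by (simp add: window_load_def)

lemma window_load_add:
  "window_load next_arc S s (k + l) e = window_load next_arc S s k e + window_load next_arc S (s + k) l e"
  by (induction l) (simp_all add: window_load_Suc add.assoc)

lemma load_eq_visits:
  "load next_arc s e = visits next_arc (pointer s (fst e)) (tokens s (fst e)) e"
  by (simp add: load_def visits_def)

locale rotor_run = rotor_router V E next_arc
  for V :: "'v set" and E next_arc +
  fixes S :: "nat \<Rightarrow> 'v rr_state"
  assumes run: "is_run V E next_arc S"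
begin

abbreviation W where "W \<equiv> window_load next_arc S"

lemma finite_edges: "finite E"
proof -
  have "E \<subseteq> Pow V" using edges by auto
  then show ?thesis using finite_vertices by (metis finite_Pow_iff finite_subset)
qed

lemma arc_ends:
  assumes "e \<in> arcs E"
  shows "fst e \<in> V" "snd e \<in> V"
  using assms edges by (auto simp: arcs_def doubleton_eq_iff)

lemma finite_arcs: "finite (arcs E)"
proof (rule finite_subset)
  show "arcs E \<subseteq> V \<times> V" using arc_ends by fastforce
qed (simp add: finite_vertices)

lemma finite_in_arcs: "finite (in_arcs E v)"
  using finite_arcs by (simp add: in_arcs_def)

lemma finite_out_arcs: "finite (out_arcs E v)"
  using finite_arcs by (simp add: out_arcs_def)

lemma card_arcs_le: "card (arcs E) \<le> 2 * card E"
proof -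
  define A where "A e = {(u, v). {u, v} = e}" for e :: "'v set"
  have le: "card (A e) \<le> 2" if e: "e \<in> E" for e
  proof -
    obtain u v where "e = {u, v}" using edges e by blast
    then have "A e \<subseteq> {(u, v), (v, u)}"
      by (auto simp: A_def doubleton_eq_iff)
    then have "card (A e) \<le> card {(u, v), (v, u)}"
      by (intro card_mono) simp_all
    also have "\<dots> \<le> 2" using card_length[of "[(u, v), (v, u)]"] by simp
    finally show ?thesis .
  qed
  have "arcs E = (\<Union>e\<in>E. A e)"
    by (rule set_eqI) (simp add: arcs_def A_def case_prod_beta)
  then have "card (arcs E) \<le> (\<Sum>e\<in>E. card (A e))"
    using card_UN_le[OF finite_edges, of A] by (simp only:)
  also have "\<dots> \<le> of_nat (card E) * 2"
    by (rule sum_bounded_above) (rule le)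
  finally show ?thesis by simp
qed

lemma card_in_arcs_eq_out_arcs: "card (in_arcs E v) = card (out_arcs E v)"
proof (rule bij_betw_same_card)
  show "bij_betw prod.swap (in_arcs E v) (out_arcs E v)"
    by (rule bij_betw_byWitness[where f' = prod.swap])
      (auto simp: in_arcs_def out_arcs_def arcs_def insert_commute)
qed

text \<open>Grouping by heads here and by tails in \<open>sum_arcs_out\<close> lets comparisons of
  incoming with outgoing arcs at each vertex add up to one between sums over all arcs.\<close>

lemma sum_arcs_in: "(\<Sum>e\<in>arcs E. g e) = (\<Sum>v\<in>V. \<Sum>e\<in>in_arcs E v. g e)"
  unfolding in_arcs_def using arc_ends
  by (intro sum.group[symmetric] finite_arcs finite_vertices) auto

lemma sum_arcs_out: "(\<Sum>e\<in>arcs E. g e) = (\<Sum>v\<in>V. \<Sum>e\<in>out_arcs E v. g e)"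
  unfolding out_arcs_def using arc_ends
  by (intro sum.group[symmetric] finite_arcs finite_vertices) auto

lemma step: "S (Suc t) = step E next_arc (S t)"
  using run by (simp add: is_run_def)

lemma tokens_Suc: "tokens (S (Suc t)) v = (\<Sum>e\<in>in_arcs E v. load next_arc (S t) e)"
  by (simp add: step Defs.step_def)

lemma pointer_Suc: "pointer (S (Suc t)) v = (next_arc ^^ tokens (S t) v) (pointer (S t) v)"
  by (simp add: step Defs.step_def)

lemma is_state: "is_state V E (S t)"
proof (induction t)
  case 0
  then show ?case using run by (simp add: is_run_def)
next
  case (Suc t)
  have "pointer (S (Suc t)) v \<in> out_arcs E v" if "v \<in> V" for v
  proof -
    have "pointer (S t) v \<in> out_arcs E v" using Suc that by (simp add: is_state_def)
    then show ?thesis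
      unfolding pointer_Suc using cyclic_ordering[OF that]
      by (metis cyclic_on_funpow_in empty_iff)
  qed
  moreover have "tokens (S (Suc t)) v = 0" if "v \<notin> V" for v
  proof -
    have "in_arcs E v = {}" using that arc_ends by (auto simp: in_arcs_def)
    then show ?thesis by (simp add: tokens_Suc)
  qed
  ultimately show ?case by (simp add: is_state_def)
qed

lemma pointer_in: "v \<in> V \<Longrightarrow> pointer (S t) v \<in> out_arcs E v"
  using is_state by (simp add: is_state_def)

lemma tokens_outside: "v \<notin> V \<Longrightarrow> tokens (S t) v = 0"
  using is_state by (simp add: is_state_def)

text \<open>The pointer of a state is an outgoing arc, so the case of an isolated vertex cannot
  occur in a run.\<close>

lemma cyclic_out: "v \<in> V \<Longrightarrow> cyclic_on next_arc (out_arcs E v)"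
  using cyclic_ordering pointer_in by (metis empty_iff)

lemma pointer_add:
  "pointer (S (s + k)) v = (next_arc ^^ (\<Sum>i<k. tokens (S (s + i)) v)) (pointer (S s) v)"
proof (induction k)
  case (Suc k)
  then show ?case
    by (simp add: pointer_Suc funpow_add add.commute[of "sum _ _"])
qed simp

text \<open>Each step resumes the rotor where the previous one stopped, so a window acts like a
  single step sending all its tokens.\<close>

lemma window_load_eq_visits:
  "W s k e = visits next_arc (pointer (S s) (fst e)) (\<Sum>i<k. tokens (S (s + i)) (fst e)) e"
proof (induction k)
  case (Suc k)
  then show ?case
    by (simp add: window_load_Suc visits_add load_eq_visits pointer_add)
qed simp

lemma sum_load_out:
  assumes "v \<in> V"
  shows "(\<Sum>e\<in>out_arcs E v. load next_arc (S t) e) = tokens (S t) v"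
proof -
  have "(\<Sum>e\<in>out_arcs E v. load next_arc (S t) e) =
      (\<Sum>e\<in>out_arcs E v. visits next_arc (pointer (S t) v) (tokens (S t) v) e)"
    by (rule sum.cong) (auto simp: load_eq_visits out_arcs_def)
  then show ?thesis using sum_visits[OF cyclic_out pointer_in] assms by simp
qed

text \<open>Tokens sent into \<open>v\<close> at one step leave it at the next, hence the shift of
  the window by one.\<close>

lemma sum_window_load:
  assumes "v \<in> V"
  shows "(\<Sum>e\<in>out_arcs E v. W (Suc s) k e) = (\<Sum>e\<in>in_arcs E v. W s k e)"
  by (induction k) (simp_all add: window_load_Suc sum.distrib sum_load_out[OF assms] tokens_Suc)

lemma sum_window_load_int:
  assumes "v \<in> V"
  shows "(\<Sum>e\<in>in_arcs E v. int (W s k e)) = (\<Sum>e\<in>out_arcs E v. int (W (Suc s) k e))"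
  using sum_window_load[OF assms, of s k] by (simp flip: of_nat_sum)

lemma window_load_two_values:
  assumes "v \<in> V" "e \<in> out_arcs E v" "f \<in> out_arcs E v"
  shows "\<exists>D. \<forall>k. int (W s k e) - int (W s k f) \<in> {D, D + 1}"
proof -
  have "fst e = v" "fst f = v" using assms by (auto simp: out_arcs_def)
  then show ?thesis
    using visits_two_values[OF cyclic_out pointer_in assms(2,3), of s] assms(1)
    unfolding window_load_eq_visits by metis
qed

lemma window_load_out_balanced:
  assumes "v \<in> V" "e \<in> out_arcs E v" "f \<in> out_arcs E v"
  shows "\<bar>int (W s k e) - int (W s k f)\<bar> \<le> 1"
proof -
  from window_load_two_values[OF assms, of s]
  obtain D where D: "\<forall>k. int (W s k e) - int (W s k f) \<in> {D, D + 1}" ..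
  \<comment> \<open>The empty window has difference 0.\<close>
  have "D = 0 \<or> D = - 1" using spec[OF D, of 0] by auto
  then show ?thesis using spec[OF D, of k] by auto
qed

lemma subcycle_decomposition_mono:
  "subcycle_decomposition V E next_arc S T d \<Longrightarrow> d' \<le> d \<Longrightarrow>
    subcycle_decomposition V E next_arc S T d'"
  unfolding subcycle_decomposition_def
  by (intro ballI, drule bspec, assumption, elim exE conjE, intro exI conjI) auto

section \<open>Stable states admit subcycle decompositions\<close>

text \<open>A Lyapunov function of the window's start \<open>s\<close>, one for each window length
  \<open>k\<close>.\<close>

definition potential :: "nat \<Rightarrow> nat \<Rightarrow> int" where
  "potential k s = (\<Sum>e\<in>arcs E. (int (W s k e))\<^sup>2)"

lemma squares_out_le_in:
  assumes "v \<in> V"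
  shows "(\<Sum>e\<in>out_arcs E v. (int (W (Suc s) k e))\<^sup>2) \<le> (\<Sum>e\<in>in_arcs E v. (int (W s k e))\<^sup>2)"
  by (rule sum_squares_balanced(1)[OF finite_in_arcs finite_out_arcs card_in_arcs_eq_out_arcs
        sum_window_load_int[OF assms] window_load_out_balanced[OF assms]])

lemma potential_Suc_le: "potential k (Suc s) \<le> potential k s"
proof -
  have "potential k (Suc s) = (\<Sum>v\<in>V. \<Sum>e\<in>out_arcs E v. (int (W (Suc s) k e))\<^sup>2)"
    by (simp add: potential_def sum_arcs_out)
  also have "\<dots> \<le> (\<Sum>v\<in>V. \<Sum>e\<in>in_arcs E v. (int (W s k e))\<^sup>2)"
    by (intro sum_mono squares_out_le_in)
  also have "\<dots> = potential k s"
    by (simp add: potential_def sum_arcs_in)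
  finally show ?thesis .
qed

text \<open>Equality of the totals forces equality in \<open>squares_out_le_in\<close> at each
  vertex, and the equality case of \<open>sum_squares_balanced\<close> carries balance over to the
  incoming arcs.\<close>

lemma in_balanced_if_potential_eq:
  assumes eq: "potential k (Suc s) = potential k s"
    and v: "v \<in> V" and mem: "e \<in> in_arcs E v" "f \<in> in_arcs E v"
  shows "\<bar>int (W s k e) - int (W s k f)\<bar> \<le> 1"
proof -
  have "(\<Sum>v\<in>V. \<Sum>e\<in>out_arcs E v. (int (W (Suc s) k e))\<^sup>2) =
      (\<Sum>v\<in>V. \<Sum>e\<in>in_arcs E v. (int (W s k e))\<^sup>2)"
    using eq by (simp add: potential_def flip: sum_arcs_in sum_arcs_out)
  then have squares: "(\<Sum>e\<in>out_arcs E v. (int (W (Suc s) k e))\<^sup>2) =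
      (\<Sum>e\<in>in_arcs E v. (int (W s k e))\<^sup>2)"
    by (rule sum_mono_inv[OF _ squares_out_le_in v finite_vertices])
  show ?thesis
    by (rule sum_squares_balanced(2)[where A = "in_arcs E v" and B = "out_arcs E v"
          and x = "\<lambda>e. int (W s k e)" and y = "\<lambda>e. int (W (Suc s) k e)"])
      (fact finite_in_arcs finite_out_arcs card_in_arcs_eq_out_arcs sum_window_load_int[OF v]
        window_load_out_balanced[OF v] squares mem)+
qed

lemma stable_potential:
  assumes "stable_at S T" "T \<le> s"
  shows "potential k (Suc s) = potential k s"
proof -
  obtain p where p: "0 < p" "S (T + p) = S T"
    using assms(1) by (auto simp: stable_at_def dest: less_imp_add_positive)
  have per: "S (T + j + p) = S (T + j)" for j
  proof (induction j)
    case (Suc j)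
    then show ?case by (simp add: step)
  qed (simp add: p)
  obtain j where s: "s = T + j" using assms(2) le_Suc_ex by blast
  have per': "S (s + p + i) = S (s + i)" for i
    using per[of "j + i"] by (simp add: s ac_simps)
  have "potential k (s + p) = potential k s"
    unfolding potential_def window_load_def by (simp add: per')
  moreover have anti: "potential k (a + n) \<le> potential k a" for a n
  proof (induction n)
    case (Suc n)
    then show ?case using potential_Suc_le[of k "a + n"] by simp
  qed simp
  \<comment> \<open>A return to the same value after \<open>p\<close> steps, together with
    monotonicity over the last \<open>p - 1\<close> of them, rules out a drop at the first.\<close>
  moreover have "s + p = Suc s + (p - 1)" using p by simp
  ultimately have "potential k s \<le> potential k (Suc s)" by (metis anti)
  then show ?thesis using potential_Suc_le[of k s] by simp
qed

lemma stable_imp_subcycle_decomposition: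
  assumes "stable_at S T"
  shows "subcycle_decomposition V E next_arc S T d"
  unfolding subcycle_decomposition_def
proof
  fix v assume v: "v \<in> V"
  have two_in: "\<exists>D. \<forall>k. int (W T k e) - int (W T k f) \<in> {D, D + 1}"
    if mem: "e \<in> in_arcs E v" "f \<in> in_arcs E v" for e f
  proof (rule two_values_if_close)
    \<comment> \<open>Between times \<open>i\<close> and \<open>i + l\<close> the cumulative
      difference changes by the difference of the loads of the window of length \<open>l\<close>
      starting at \<open>T + i\<close>, which is balanced.\<close>
    have "\<bar>(int (W T (i + l) e) - int (W T (i + l) f)) - (int (W T i e) - int (W T i f))\<bar> \<le> 1" for i l
      using in_balanced_if_potential_eq[OF stable_potential[OF assms, of "T + i"] v mem, of l]
      by (simp add: window_load_add)
    then have mono: "\<bar>(int (W T j e) - int (W T j f)) - (int (W T i e) - int (W T i f))\<bar> \<le> 1"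
      if "i \<le> j" for i j
      using that le_Suc_ex by blast
    show "\<bar>(int (W T i e) - int (W T i f)) - (int (W T j e) - int (W T j f))\<bar> \<le> 1" for i j
      using mono[of i j] mono[of j i] by linarith
  qed
  have "\<exists>M. bij_betw M (in_arcs E v) (out_arcs E v) \<and>
      (\<forall>e\<in>in_arcs E v. \<forall>k\<le>d. W T k e = W (Suc T) k (M e))"
    using sum_window_load[OF v] two_in window_load_two_values[OF v]
    by (intro ex_matching[where x = "\<lambda>e k. W T k e" and y = "\<lambda>e k. W (Suc T) k e"]
        finite_in_arcs finite_out_arcs card_in_arcs_eq_out_arcs) auto
  then obtain M where M: "bij_betw M (in_arcs E v) (out_arcs E v)"
    "\<And>e k. e \<in> in_arcs E v \<Longrightarrow> k \<le> d \<Longrightarrow> W T k e = W (Suc T) k (M e)"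
    by blast
  \<comment> \<open>A single load is the increment of a cumulative load from \<open>k\<close> to
    \<open>Suc k\<close>, so agreement up to \<open>d\<close> covers \<open>d\<close> steps.\<close>
  have "load next_arc (S t) e = load next_arc (S (t + 1)) (M e)"
    if e: "e \<in> in_arcs E v" and t: "T \<le> t \<and> t < T + d" for e t
  proof -
    obtain k where "t = T + k" "k < d" using t by (metis le_Suc_ex nat_add_left_cancel_less)
    then show ?thesis
      using M(2)[OF e, of k] M(2)[OF e, of "Suc k"] by (simp add: window_load_Suc)
  qed
  with M(1) show "\<exists>M. bij_betw M (in_arcs E v) (out_arcs E v) \<and>
      (\<forall>e\<in>in_arcs E v. \<forall>t. T \<le> t \<and> t < T + d \<longrightarrow>
        load next_arc (S t) e = load next_arc (S (t + 1)) (M e))"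
    by blast
qed

section \<open>Subcycle decompositions imply stability\<close>

text \<open>The inverses of the bijections \<open>M v\<close> glue together because every arc has
  exactly one tail and one head. Thus \<open>s\<close> points backwards in time: it leads to the
  incoming arc whose load \<open>e\<close> repeats one step later.\<close>

lemma ex_arc_permutation:
  assumes "subcycle_decomposition V E next_arc S T d"
  shows "\<exists>s. s permutes arcs E \<and> (\<forall>v\<in>V. bij_betw s (out_arcs E v) (in_arcs E v)) \<and>
    (\<forall>e\<in>arcs E. \<forall>j<d. load next_arc (S (T + Suc j)) e = load next_arc (S (T + j)) (s e))"
proof -
  obtain M where M: "\<And>v. v \<in> V \<Longrightarrow> bij_betw (M v) (in_arcs E v) (out_arcs E v)"
    "\<And>v e t. v \<in> V \<Longrightarrow> e \<in> in_arcs E v \<Longrightarrow> T \<le> t \<Longrightarrow> t < T + d \<Longrightarrow>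
      load next_arc (S t) e = load next_arc (S (t + 1)) (M v e)"
    using assms unfolding subcycle_decomposition_def by metis
  define s where "s e = (if e \<in> arcs E then inv_into (in_arcs E (fst e)) (M (fst e)) e else e)" for e
  have s_eq: "s e = inv_into (in_arcs E v) (M v) e" if "e \<in> out_arcs E v" for e v
    using that by (auto simp: s_def out_arcs_def)
  have s_bij: "bij_betw s (out_arcs E v) (in_arcs E v)" if "v \<in> V" for v
    using bij_betw_inv_into[OF M(1)[OF that]] s_eq by (subst bij_betw_cong) auto
  have out: "e \<in> out_arcs E (fst e)" if "e \<in> arcs E" for e
    using that by (simp add: out_arcs_def)
  have s_in: "s e \<in> in_arcs E (fst e)" if "e \<in> arcs E" for e
    using bij_betwE[OF s_bij] arc_ends(1) out that by blast
  have "s permutes arcs E"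
  proof (rule bij_imp_permutes)
    have "inj_on s (arcs E)"
    proof (rule inj_onI)
      fix e f assume ef: "e \<in> arcs E" "f \<in> arcs E" "s e = s f"
      \<comment> \<open>The head of \<open>s e\<close> is the tail of \<open>e\<close>.\<close>
      then have "fst e = fst f"
        using s_in[of e] s_in[of f] by (simp add: in_arcs_def)
      then show "e = f"
        using ef out[of e] out[of f] arc_ends s_bij[of "fst e"]
        by (auto simp: bij_betw_def dest: inj_onD)
    qed
    moreover have "s ` arcs E \<subseteq> arcs E" using s_in by (auto simp: in_arcs_def)
    ultimately show "bij_betw s (arcs E) (arcs E)"
      unfolding bij_betw_def using finite_arcs by (simp add: endo_inj_surj)
  qed (simp add: s_def)
  moreover have "load next_arc (S (T + Suc j)) e = load next_arc (S (T + j)) (s e)"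
    if "e \<in> arcs E" "j < d" for e j
  proof -
    have "M (fst e) (s e) = e"
      unfolding s_eq[OF out[OF that(1)]]
      using M(1)[of "fst e"] arc_ends that(1) out by (auto simp: bij_betw_def f_inv_into_f)
    then show ?thesis
      using M(2)[OF arc_ends(1)[OF that(1)] s_in[OF that(1)], of "T + j"] that by simp
  qed
  ultimately show ?thesis using s_bij by blast
qed

text \<open>\<open>load next_arc (S T) ((s ^^ j) e)\<close> is the load predicted for \<open>e\<close> at time \<open>T + j\<close> if the
  decomposition never broke down.\<close>
lemma subcycle_decomposition_loads:
  assumes d: "subcycle_decomposition V E next_arc S T (2 * card E ^ 2)"
  shows "\<exists>s. s permutes arcs E \<and>
    (\<forall>j. \<forall>e\<in>arcs E. load next_arc (S (T + j)) e = load next_arc (S T) ((s ^^ j) e))"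
proof -
  obtain s where s: "s permutes arcs E"
    and s_bij: "\<And>v. v \<in> V \<Longrightarrow> bij_betw s (out_arcs E v) (in_arcs E v)"
    and s_load: "\<And>e j. e \<in> arcs E \<Longrightarrow> j < 2 * card E ^ 2 \<Longrightarrow>
      load next_arc (S (T + Suc j)) e = load next_arc (S (T + j)) (s e)"
    using ex_arc_permutation[OF d] by blast
  define L where "L j e = load next_arc (S T) ((s ^^ j) e)" for j e
  define C where "C j e = (\<Sum>i<j. L i e)" for j e
  have L_Suc: "L (Suc j) e = L j (s e)" for j e
    by (simp add: L_def funpow_swap1)
  have s_in: "s e \<in> arcs E" if "e \<in> arcs E" for e
    using s that by (simp add: permutes_in_image)
  have L_initial: "load next_arc (S (T + j)) e = L j e"
    if "j \<le> 2 * card E ^ 2" "e \<in> arcs E" for j e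
    using that
  proof (induction j arbitrary: e)
    case 0
    then show ?case by (simp add: L_def)
  next
    case (Suc j)
    then show ?case using s_load[of e j] s_in by (simp add: L_Suc)
  qed
  have C_initial: "W T j e = C j e" if "j \<le> 2 * card E ^ 2" "e \<in> arcs E" for j e
    unfolding window_load_def C_def using that L_initial by (intro sum.cong) auto
  \<comment> \<open>If \<open>s ^^ p\<close> fixes \<open>e\<close>, the loads predicted for
    \<open>e\<close> have period \<open>p\<close>, so each period adds the same amount.\<close>
  have C_period: "C (j + p) e = C j e + C p e" if "(s ^^ p) e = e" for j p e
  proof (induction j)
    case (Suc j)
    have "L (j + p) e = L j e" using that by (simp add: L_def funpow_add)
    with Suc show ?case by (simp add: C_def)
  qed (simp add: C_def)
  \<comment> \<open>Actual loads obey one \<open>D\<close> at all times. The prediction coincides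
    with them for two common periods, as \<open>2 * p \<le> 2 * card E ^ 2\<close>, so
    \<open>two_values_extend\<close> gives it the same \<open>D\<close> forever.\<close>
  have two: "\<exists>D. \<forall>j. int (W T j e) - int (W T j f) \<in> {D, D + 1} \<and>
      int (C j e) - int (C j f) \<in> {D, D + 1}"
    if v: "v \<in> V" and mem: "e \<in> out_arcs E v" "f \<in> out_arcs E v" for v e f
  proof (cases "e = f")
    case True
    then show ?thesis by (intro exI[of _ 0]) simp
  next
    case False
    from window_load_two_values[OF v mem, of T]
    obtain D where D: "\<forall>j. int (W T j e) - int (W T j f) \<in> {D, D + 1}" ..
    have arcs: "e \<in> arcs E" "f \<in> arcs E" "fst e = v" "fst f = v"
      using mem by (auto simp: out_arcs_def)
    \<comment> \<open>Distinct arcs with a common tail come from distinct edges, which provides the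
      bound \<open>2 \<le> card E\<close> for \<open>permutes_common_period\<close>.\<close>
    have "{fst e, snd e} \<noteq> {fst f, snd f}"
      using arcs False by (auto simp: doubleton_eq_iff prod_eq_iff)
    moreover have "{{fst e, snd e}, {fst f, snd f}} \<subseteq> E"
      using arcs by (auto simp: arcs_def)
    ultimately have "2 \<le> card E"
      using finite_edges by (metis card_2_iff card_mono)
    then obtain p where p: "0 < p" "p \<le> card E ^ 2" "(s ^^ p) e = e" "(s ^^ p) f = f"
      using permutes_common_period[OF s finite_arcs card_arcs_le _ arcs(1,2)] by blast
    have "int (C j e) - int (C j f) \<in> {D, D + 1}" for j
    proof (rule two_values_extend[where q = "\<lambda>j. int (C j e) - int (C j f)"])
      show "int (C (j + p) e) - int (C (j + p) f) =
          int (C j e) - int (C j f) + (int (C p e) - int (C p f))" for j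
        by (simp add: C_period p)
      show "int (C j e) - int (C j f) \<in> {D, D + 1}" if "j \<le> 2 * p" for j
        using spec[OF D, of j] C_initial[of j] arcs that p(2) by simp
    qed (rule p)
    with D show ?thesis by blast
  qed
  \<comment> \<open>Agreement before \<open>j\<close> yields equal totals at each vertex at time
    \<open>j\<close>, since what leaves is what arrived one step before and \<open>s\<close> matches
    outgoing with incoming arcs. Then \<open>two\<close> and \<open>two_values_unique\<close> settle
    the individual arcs.\<close>
  have "\<forall>e\<in>arcs E. load next_arc (S (T + j)) e = L j e" for j
  proof (induction j rule: less_induct)
    case (less j)
    show ?case
    proof (cases j)
      case 0
      then show ?thesis by (simp add: L_def)
    next
      case (Suc i)
      have C_eq: "W T j e = C j e" if "e \<in> arcs E" for e
        unfolding window_load_def C_def using that less by (intro sum.cong) auto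
      show ?thesis
      proof
        fix e assume e: "e \<in> arcs E"
        define v where "v = fst e"
        have v: "v \<in> V" and out: "e \<in> out_arcs E v"
          using e arc_ends by (auto simp: v_def out_arcs_def)
        have sums: "(\<Sum>f\<in>out_arcs E v. W T (Suc j) f) = (\<Sum>f\<in>out_arcs E v. C (Suc j) f)"
        proof -
          have "(\<Sum>f\<in>out_arcs E v. load next_arc (S (T + j)) f) =
              (\<Sum>f\<in>in_arcs E v. load next_arc (S (T + i)) f)"
            by (simp add: sum_load_out v Suc tokens_Suc)
          also have "\<dots> = (\<Sum>f\<in>in_arcs E v. L i f)"
            using less[of i] Suc by (intro sum.cong) (auto simp: in_arcs_def)
          also have "\<dots> = (\<Sum>f\<in>out_arcs E v. L j f)"
            using sum.reindex_bij_betw[OF s_bij[OF v], of "L i"] by (simp add: Suc L_Suc)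
          finally have "(\<Sum>f\<in>out_arcs E v. load next_arc (S (T + j)) f) =
              (\<Sum>f\<in>out_arcs E v. L j f)" .
          moreover have "(\<Sum>f\<in>out_arcs E v. W T j f) = (\<Sum>f\<in>out_arcs E v. C j f)"
            using C_eq by (intro sum.cong) (auto simp: out_arcs_def)
          ultimately show ?thesis
            by (simp add: window_load_Suc C_def sum.distrib)
        qed
        have "int (W T (Suc j) e) = int (C (Suc j) e)"
        proof (rule two_values_unique[where A = "out_arcs E v"
              and x = "\<lambda>e. int (W T (Suc j) e)" and y = "\<lambda>e. int (C (Suc j) e)"])
          show "(\<Sum>f\<in>out_arcs E v. int (W T (Suc j) f)) = (\<Sum>f\<in>out_arcs E v. int (C (Suc j) f))"
            using sums by (simp flip: of_nat_sum)
        qed (use two[OF v] out finite_out_arcs in blast)+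
        then show "load next_arc (S (T + j)) e = L j e"
          using C_eq[OF e] by (simp add: window_load_Suc C_def)
      qed
    qed
  qed
  with s show ?thesis unfolding L_def by blast
qed

text \<open>Loads, and hence token counts, repeat after any \<open>P\<close> with
  \<open>s ^^ P = id\<close>. The rotors need not be back by then, so \<open>P\<close> is multiplied
  by a number \<open>n\<close> that makes each of them complete whole turns.\<close>

lemma subcycle_decomposition_imp_stable:
  assumes "subcycle_decomposition V E next_arc S T (2 * card E ^ 2)"
  shows "stable_at S T"
proof -
  obtain s where s: "s permutes arcs E"
    and load: "\<And>j e. e \<in> arcs E \<Longrightarrow>
      load next_arc (S (T + j)) e = load next_arc (S T) ((s ^^ j) e)"
    using subcycle_decomposition_loads[OF assms] by blast
  have "permutation s" using s finite_arcs by (auto simp: permutation_permutes)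
  then obtain P where P: "s ^^ P = id" "0 < P"
    using permutation_is_nilpotent by blast
  have tokens: "tokens (S (T + j + P)) v = tokens (S (T + j)) v" for j v
  proof (cases "v \<in> V")
    case True
    have "(\<Sum>e\<in>out_arcs E v. load next_arc (S (T + (j + P))) e) =
        (\<Sum>e\<in>out_arcs E v. load next_arc (S (T + j)) e)"
    proof (rule sum.cong)
      fix e assume "e \<in> out_arcs E v"
      then have "e \<in> arcs E" by (simp add: out_arcs_def)
      then show "load next_arc (S (T + (j + P))) e = load next_arc (S (T + j)) e"
        by (simp only: load funpow_add P comp_id)
    qed simp
    then show ?thesis by (simp add: sum_load_out[OF True] add.assoc)
  qed (simp add: tokens_outside)
  define K where "K v = (\<Sum>i<P. tokens (S (T + i)) v)" for v
  have sum_tokens: "(\<Sum>i<n * P. tokens (S (T + i)) v) = n * K v" for n v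
  proof -
    have "(\<Sum>i<n * P. tokens (S (T + i)) v) =
        (\<Sum>i<n. \<Sum>i\<in>{i * P..<i * P + P}. tokens (S (T + i)) v)"
      using sum.nat_group[of "\<lambda>i. tokens (S (T + i)) v" P n] by simp
    also have "\<dots> = (\<Sum>i<n. K v)"
    proof (rule sum.cong)
      fix i
      have "tokens (S (T + (l + i * P))) v = tokens (S (T + l)) v" for l
      proof (induction i)
        case (Suc i)
        then show ?case using tokens[of "l + i * P" v] by (simp add: ac_simps)
      qed simp
      then show "(\<Sum>i\<in>{i * P..<i * P + P}. tokens (S (T + i)) v) = K v"
        using sum.shift_bounds_nat_ivl[of "\<lambda>i. tokens (S (T + i)) v" 0 "i * P" P]
        by (simp add: K_def add.commute atLeast0LessThan)
    qed simp
    finally show ?thesis by simp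
  qed
  \<comment> \<open>Every out-degree divides \<open>n\<close>, hence also the number
    \<open>n * K v\<close> of tokens that \<open>v\<close> sends in \<open>n * P\<close>
    steps.\<close>
  define n where "n = (\<Prod>v\<in>V. card (out_arcs E v))"
  \<comment> \<open>Each vertex has a pointer among its outgoing arcs; this makes \<open>n\<close>
    positive and the return time strictly later than \<open>T\<close>.\<close>
  have "card (out_arcs E v) \<noteq> 0" if "v \<in> V" for v
    using pointer_in[OF that] finite_out_arcs by (metis card_0_eq empty_iff)
  then have "0 < n" by (simp add: n_def prod_pos)
  have "tokens (S (T + n * P)) v = tokens (S T) v" for v
  proof (induction n)
    case (Suc n)
    then show ?case using tokens[of "n * P" v] by (simp add: ac_simps)
  qed simp
  moreover have "pointer (S (T + n * P)) v = pointer (S T) v" for v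
  proof (cases "v \<in> V")
    case True
    then have "card (out_arcs E v) dvd n * K v"
      unfolding n_def using finite_vertices by (intro dvd_mult2 dvd_prodI)
    then show ?thesis
      unfolding pointer_add sum_tokens
      using cyclic_on_funpow_dvd[OF cyclic_out pointer_in] True by blast
  qed (simp add: pointer_add tokens_outside)
  ultimately have "S (T + n * P) = S T"
    by (intro rr_state.equality) auto
  moreover have "T < T + n * P" using \<open>0 < n\<close> P by simp
  ultimately show ?thesis unfolding stable_at_def by blast
qed

end

section \<open>Equivalence of stability with infinite and finite decompositions\<close>

theorem theorem2:
  fixes V :: "'v set" and E :: "'v set set"
    and next_arc :: "'v \<times> 'v \<Rightarrow> 'v \<times> 'v"
    and S :: "nat \<Rightarrow> 'v rr_state" and T m :: nat
  assumes "rotor_router V E next_arc"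
    and "m = card E"
    and "is_run V E next_arc S"
  shows "(stable_at S T \<longleftrightarrow> infinite_subcycle_decomposition V E next_arc S T) \<and>
    (infinite_subcycle_decomposition V E next_arc S T \<longleftrightarrow>
       subcycle_decomposition V E next_arc S T (2 * m ^ 2))"
proof -
  interpret rotor_run V E next_arc S
    using assms by (simp add: rotor_run_def rotor_run_axioms_def)
  have "infinite_subcycle_decomposition V E next_arc S T" if "stable_at S T"
    using stable_imp_subcycle_decomposition[OF that]
    by (auto simp: infinite_subcycle_decomposition_def)
  \<comment> \<open>Some decomposition lasts at least \<open>2 * m ^ 2\<close> steps, and it
    restricts to the first \<open>2 * m ^ 2\<close> of them.\<close>
  moreover have "subcycle_decomposition V E next_arc S T (2 * m ^ 2)"
    if "infinite_subcycle_decomposition V E next_arc S T"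
    using that subcycle_decomposition_mono by (auto simp: infinite_subcycle_decomposition_def)
  ultimately show ?thesis
    using subcycle_decomposition_imp_stable assms(2) by blast
qed

end
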